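(* For a natural number $n$, $$\varphi(n)=-\frac{n(n-1)}{2}+2\,\sum_{j=1}^{n-1}\sum_{k=1}^{n}\left\lfloor\frac{jk}{n}\right\rfloor\,\cos\left(\frac{2k\pi}{n}\right).$$
   Context: $\varphi(n)$ is Euler's totient function, defined as $\varphi(n)=\sum_{\substack{k=1\\ \gcd(k,n)=1}}^{n-1}1$, where $\gcd(k,n)$ denotes the greatest common divisor of $k$ and $n$. $\lfloor x\rfloor$ denotes the integer part (floor) of $x$. *)

theory Defs
  imports Complex_Main "HOL-Number_Theory.Totient"
begin

(* The summation range is 1 <= k <= n - 1, so euler_phi 1 = 0, whereas the library has
   totient 1 = 1.  The two functions agree for every n other than 1 (euler_phi_eq_totient
   below), but the identity for n = 1 holds only with this convention. *)
definition euler_phi :: "nat \<Rightarrow> nat" where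
  "euler_phi n = (\<Sum>k | k \<in> {1..n - 1} \<and> gcd k n = 1. 1)"

lemma euler_phi_1: "euler_phi 1 = 0"
  by (simp add: euler_phi_def)

lemma euler_phi_eq_totient:
  assumes "n \<noteq> 1"
  shows "euler_phi n = totient n"
proof -
  have "k \<noteq> n" if "coprime k n" for k
    using that assms by auto
  then have "{k. k \<in> {1..n - 1} \<and> gcd k n = 1} = totatives n"
    by (force simp: totatives_def coprime_iff_gcd_eq_1)
  then show ?thesis
    by (simp add: euler_phi_def totient_def)
qed

end

theory Submission
  imports Defs
begin

text \<open>
  Pairing the index \<open>j\<close> with \<open>n - j\<close> replaces twice the floor by
  \<open>\<lfloor>j k / n\<rfloor> + \<lfloor>(n - j) k / n\<rfloor> = k - 1 + [n dvd j k]\<close>.  Against the weights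
  \<open>cos (2 \<pi> k / n)\<close>, the part \<open>k - 1\<close> sums over \<open>k\<close> to \<open>n / 2\<close> for each \<open>j\<close>, which gives the term
  \<open>n (n - 1) / 2\<close>.  In the other part \<open>k\<close> runs over the multiples of \<open>n / g\<close> with
  \<open>g = gcd j n\<close>, so that the cosines are the real parts of all \<open>g\<close>-th roots of unity; these sum
  to \<open>0\<close> unless \<open>g = 1\<close>, when they sum to \<open>1\<close>.
\<close>

text \<open>These are the real parts of the \<open>n\<close>-th roots of unity, whose sum vanishes
  for \<open>n > 1\<close>. Periodicity lets the index \<open>n\<close> replace the index 0.\<close>

lemma sum_cos_roots_unity:
  assumes "n \<ge> 1"
  shows "(\<Sum>k = 1..n. cos (2 * real k * pi / real n)) = (if n = 1 then 1 else 0)"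
proof (cases "n = 1")
  case False
  with assms have n: "n > 1" by simp
  have "(\<Sum>k<n. cis (2 * pi * real k / real n)) = \<Sum>{z::complex. z ^ n = 1}"
    using sum.reindex_bij_betw[OF bij_betw_roots_unity, of n "\<lambda>z. z"] n by simp
  also have "\<dots> = 0"
    using n by (rule sum_roots_unity)
  finally have "Re (\<Sum>k<n. cis (2 * pi * real k / real n)) = 0" by simp
  then have "(\<Sum>k<n. cos (2 * real k * pi / real n)) = 0"
    by (simp add: mult_ac)
  moreover have "(\<Sum>k = 1..n. cos (2 * real k * pi / real n))
      = (\<Sum>k<n. cos (2 * real k * pi / real n))"
  proof -
    have "(\<Sum>k = 1..n. f k) = (\<Sum>k<n. f k)" if "f n = f 0" for f :: "nat \<Rightarrow> real"
      using that sum.lessThan_Suc[of f n] sum.lessThan_Suc_shift[of f n]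
      by (simp add: sum.atLeast1_atMost_eq)
    from this[of "\<lambda>k. cos (2 * real k * pi / real n)"] n show ?thesis by simp
  qed
  ultimately show ?thesis using False by simp
qed simp

text \<open>The reflection of \<open>k\<close> to \<open>n - k\<close> preserves the cosine, so the
  sum S over \<open>1..n - 1\<close> satisfies S = - n - S, that is S = - n / 2. The last term,
  \<open>k = n\<close>, adds n.\<close>

lemma sum_index_times_cos:
  assumes "n > 1"
  shows "(\<Sum>k = 1..n. real k * cos (2 * real k * pi / real n)) = real n / 2"
proof -
  define c where "c k = cos (2 * real k * pi / real n)" for k :: nat
  have reflect: "c (n - k) = c k" if "k \<le> n" for k
  proof -
    have "2 * real (n - k) * pi / real n = 2 * pi - 2 * real k * pi / real n"
      using assms that by (simp add: field_simps of_nat_diff)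
    then show ?thesis by (simp add: c_def cos_diff)
  qed
  have split: "(\<Sum>k = 1..n. f k) = (\<Sum>k = 1..n - 1. f k) + f n" for f :: "nat \<Rightarrow> real"
    using assms by (cases n) auto
  have cn: "c n = 1" using assms by (simp add: c_def)
  \<comment> \<open>The full sum over \<open>1..n\<close> is 0 and its last term is 1.\<close>
  have c_sum: "(\<Sum>k = 1..n - 1. c k) = - 1"
    using sum_cos_roots_unity[of n] assms split[of c] cn by (simp add: c_def)
  have "(\<Sum>k = 1..n - 1. real k * c k) = (\<Sum>k = 1..n - 1. real (n - k) * c (n - k))"
    by (rule sum.reindex_bij_witness[of _ "\<lambda>k. n - k" "\<lambda>k. n - k"]) auto
  also have "\<dots> = (\<Sum>k = 1..n - 1. real n * c k - real k * c k)"
    by (intro sum.cong refl) (auto simp: reflect of_nat_diff algebra_simps)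
  also have "\<dots> = - real n - (\<Sum>k = 1..n - 1. real k * c k)"
    by (simp add: sum_subtractf sum_distrib_left[symmetric] c_sum del: One_nat_def)
  finally have "(\<Sum>k = 1..n. real k * c k) = real n / 2"
    using split[of "\<lambda>k. real k * c k"] cn by simp
  then show ?thesis by (simp add: c_def)
qed

text \<open>Cancelling \<open>g\<close> turns \<open>n dvd j * k\<close> into
  \<open>d dvd k\<close>, because \<open>j div g\<close> is coprime to \<open>d\<close>. Writing
  \<open>k = d * m\<close> then changes the angle into 2 pi m / g.\<close>

lemma sum_cos_dvd_mult:
  assumes "n \<ge> 1"
  shows "(\<Sum>k = 1..n. of_bool (n dvd j * k) * cos (2 * real k * pi / real n))
    = of_bool (coprime j n)"
proof -
  define g where "g = gcd j n"
  define d where "d = n div g"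
  have n: "n = d * g" and pos: "g \<ge> 1" "d \<ge> 1"
    using assms by (auto simp: d_def g_def Suc_le_eq div_greater_zero_iff dvd_imp_le)
  have dvd_iff: "n dvd j * k \<longleftrightarrow> d dvd k" for k
  proof -
    have j: "j = (j div g) * g" by (simp add: g_def)
    have "coprime (j div g) d"
      using assms unfolding d_def g_def by (intro div_gcd_coprime) auto
    moreover have "n dvd j * k \<longleftrightarrow> d * g dvd ((j div g) * k) * g"
      using n j by (metis mult.assoc mult.commute)
    ultimately show ?thesis
      using pos by (simp add: coprime_commute coprime_dvd_mult_right_iff)
  qed
  have "(\<Sum>k = 1..n. of_bool (n dvd j * k) * cos (2 * real k * pi / real n))
      = (\<Sum>k \<in> {k \<in> {1..n}. d dvd k}. cos (2 * real k * pi / real n))"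
    unfolding sum.inter_filter[OF finite_atLeastAtMost] dvd_iff by (intro sum.cong) auto
  also have "\<dots> = (\<Sum>m = 1..g. cos (2 * real m * pi / real g))"
    by (rule sum.reindex_bij_witness[of _ "\<lambda>m. d * m" "\<lambda>k. k div d"])
      (use pos in \<open>auto simp: n Suc_le_eq mult.assoc elim!: dvdE\<close>)
  also have "\<dots> = of_bool (coprime j n)"
    using sum_cos_roots_unity[OF pos(1)] by (simp add: g_def coprime_iff_gcd_eq_1)
  finally show ?thesis .
qed

text \<open>With x = j k / n the second floor is that of k - x, which is k minus the ceiling of x.
  Ceiling and floor of x differ by 1 unless x is an integer, that is, unless n divides j k.\<close>

lemma floor_pair:
  fixes n j k :: nat
  assumes "n \<ge> 1" "j \<le> n"
  shows "real_of_int \<lfloor>real j * real k / real n\<rfloor> + real_of_int \<lfloor>real (n - j) * real k / real n\<rfloor>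
    = real k - 1 + of_bool (n dvd j * k)"
proof -
  define x where "x = real j * real k / real n"
  have "real (n - j) * real k / real n = of_int (int k) - x"
    using assms by (simp add: x_def field_simps of_nat_diff)
  then have "\<lfloor>real (n - j) * real k / real n\<rfloor> = int k - \<lceil>x\<rceil>"
    by (simp add: ceiling_def) linarith
  moreover have "x = of_int \<lfloor>x\<rfloor> \<longleftrightarrow> n dvd j * k"
  proof -
    have fl: "\<lfloor>x\<rfloor> = int (j * k div n)"
      using floor_divide_of_nat_eq[of "j * k" n, where ?'a = real] by (simp add: x_def)
    have "x = of_int \<lfloor>x\<rfloor> \<longleftrightarrow> real (j * k) = real (j * k div n * n)"
      unfolding fl using assms by (simp add: x_def field_simps)
    also have "\<dots> \<longleftrightarrow> n dvd j * k"
      by (metis dvd_div_mult_self dvd_triv_right of_nat_eq_iff)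
    finally show ?thesis .
  qed
  ultimately show ?thesis
    by (auto simp: ceiling_altdef x_def[symmetric])
qed

lemma euler_phi_eq_sum: "real (euler_phi n) = (\<Sum>j = 1..n - 1. of_bool (coprime j n))"
proof -
  have "{k. k \<in> {1..n - 1} \<and> gcd k n = 1} = {1..n - 1} \<inter> {k. coprime k n}"
    by (auto simp: coprime_iff_gcd_eq_1)
  then show ?thesis by (simp add: euler_phi_def sum_of_bool_eq)
qed

theorem mainTheorem2:
  fixes n :: nat
  assumes "n \<ge> 1"
  shows "real (euler_phi n) =
    - (real n * (real n - 1) / 2)
    + 2 * (\<Sum>j = 1..n - 1. \<Sum>k = 1..n.
        real_of_int \<lfloor>real j * real k / real n\<rfloor> * cos (2 * real k * pi / real n))"
proof (cases "n = 1")
  \<comment> \<open>Both sides are 0: the sum over \<open>j\<close> is empty and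
    \<open>euler_phi 1 = 0\<close>.\<close>
  case True
  then show ?thesis by (simp add: euler_phi_def)
next
  case False
  with assms have n: "n > 1" by simp
  define c where "c k = cos (2 * real k * pi / real n)" for k :: nat
  define F where "F j = (\<Sum>k = 1..n. real_of_int \<lfloor>real j * real k / real n\<rfloor> * c k)" for j :: nat
  \<comment> \<open>The summand - 1 from \<open>floor_pair\<close> contributes nothing, since the
    cosines sum to 0 for \<open>n > 1\<close>.\<close>
  have pair: "F j + F (n - j) = real n / 2 + of_bool (coprime j n)" if "j \<le> n" for j
  proof -
    have "F j + F (n - j) = (\<Sum>k = 1..n. (real k - 1 + of_bool (n dvd j * k)) * c k)"
      unfolding F_def sum.distrib[symmetric] distrib_right[symmetric] floor_pair[OF assms that] ..
    also have "\<dots> = (\<Sum>k = 1..n. real k * c k) - (\<Sum>k = 1..n. c k)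
        + (\<Sum>k = 1..n. of_bool (n dvd j * k) * c k)"
      by (simp only: ring_distribs sum.distrib sum_subtractf mult_1)
    finally show ?thesis
      using sum_index_times_cos[OF n] sum_cos_roots_unity[OF assms] sum_cos_dvd_mult[OF assms] False
      by (simp add: c_def)
  qed
  have "(\<Sum>j = 1..n - 1. F j) = (\<Sum>j = 1..n - 1. F (n - j))"
    by (rule sum.reindex_bij_witness[of _ "\<lambda>j. n - j" "\<lambda>j. n - j"]) auto
  then have "2 * (\<Sum>j = 1..n - 1. F j) = (\<Sum>j = 1..n - 1. F j + F (n - j))"
    by (simp add: sum.distrib)
  also have "\<dots> = (\<Sum>j = 1..n - 1. real n / 2 + of_bool (coprime j n))"
    by (intro sum.cong refl pair) auto
  also have "\<dots> = real n * (real n - 1) / 2 + real (euler_phi n)"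
    using n by (simp only: sum.distrib euler_phi_eq_sum) (simp add: of_nat_diff)
  finally show ?thesis by (simp add: F_def c_def)
qed

end
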